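(* There exist a continuum of Hopf algebra preduals for $\ell^1(\mathbb Z_+\times\mathbb Z)$, where $\mathbb Z_+\times\mathbb Z$ is a semigroup under coordinatewise addition; that is, there is a family of cardinality $2^{\aleph_0}$ of pairwise distinct subspaces of $\ell^\infty(\mathbb Z_+\times\mathbb Z)$ each of which is a Hopf algebra predual of $\ell^1(\mathbb Z_+\times\mathbb Z)$.
   Context: $\mathbb Z_+=\{0,1,2,\dots\}$. For a semigroup $S$ (discrete), $\ell^1(S)$ is the complex convolution Banach algebra with standard unit vectors $(\delta_s)_{s\in S}$ and product determined by $\delta_s\delta_t=\delta_{st}$; its dual is identified with $\ell^\infty(S)$, with bimodule actions $(\delta_s\cdot f)(t)=f(ts)$ and $(f\cdot\delta_s)(t)=f(st)$. A predual of a Banach algebra $A$ is a norm-closed sub-bimodule $E\subseteq A^*$ which is a Banach space predual of $A$, i.e. the canonical map $A\to E^*$, $a\mapsto(\mu\mapsto\mu(a))$, is a linear isomorphism (bijective and bicontinuous, not necessarily isometric). A Hopf algebra predual of $\ell^1(S)$ is a predual $E\subseteq\ell^\infty(S)$ which is also a subalgebra of $\ell^\infty(S)$ for the pointwise product. *)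

theory Defs
  imports
    "HOL-Analysis.Analysis"
    "HOL-Library.Equipollence"
    "HOL-Library.Product_Plus"
begin

section \<open>The Banach algebra of a discrete semigroup and its dual bimodule\<close>

text \<open>
  Semigroups are written additively (not necessarily commutative), so the product \<open>st\<close>
  appears as \<open>s + t\<close>; on \<^typ>\<open>nat \<times> int\<close> this is coordinatewise addition.
\<close>

definition l1 :: "('s \<Rightarrow> complex) set" where
  "l1 = {a. (\<lambda>s. norm (a s)) summable_on UNIV}"

definition l1_norm :: "('s \<Rightarrow> complex) \<Rightarrow> real" where
  "l1_norm a = (\<Sum>\<^sub>\<infinity>s. norm (a s))"

definition l1_unit :: "'s \<Rightarrow> 's \<Rightarrow> complex" where
  "l1_unit s = (\<lambda>t. if t = s then 1 else 0)"

definition l1_conv ::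
    "('s::semigroup_add \<Rightarrow> complex) \<Rightarrow> ('s \<Rightarrow> complex) \<Rightarrow> 's \<Rightarrow> complex" where
  "l1_conv a b = (\<lambda>t. \<Sum>\<^sub>\<infinity>(r, s)\<in>{(r, s). r + s = t}. a r * b s)"

definition linf :: "('s \<Rightarrow> complex) set" where
  "linf = {f. bounded (range f)}"

definition linf_norm :: "('s \<Rightarrow> complex) \<Rightarrow> real" where
  "linf_norm f = (SUP s. norm (f s))"

definition pairing :: "('s \<Rightarrow> complex) \<Rightarrow> ('s \<Rightarrow> complex) \<Rightarrow> complex" where
  "pairing a f = (\<Sum>\<^sub>\<infinity>s. a s * f s)"

text \<open>
  The actions \<open>a \<cdot> f\<close> and \<open>f \<cdot> a\<close> of a general element \<open>a\<close> of \<^const>\<open>l1\<close>. Lemmas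
  \<open>left_act_unit\<close>, \<open>right_act_unit\<close>, \<open>pairing_left_act\<close> and \<open>pairing_right_act\<close> below confirm
  that they restrict to the translations on unit vectors and are dual to convolution.
\<close>

definition left_act ::
    "('s::semigroup_add \<Rightarrow> complex) \<Rightarrow> ('s \<Rightarrow> complex) \<Rightarrow> 's \<Rightarrow> complex" where
  "left_act a f = (\<lambda>t. \<Sum>\<^sub>\<infinity>s. a s * f (t + s))"

definition right_act ::
    "('s::semigroup_add \<Rightarrow> complex) \<Rightarrow> ('s \<Rightarrow> complex) \<Rightarrow> 's \<Rightarrow> complex" where
  "right_act f a = (\<lambda>t. \<Sum>\<^sub>\<infinity>s. a s * f (s + t))"

section \<open>Preduals\<close>

definition linf_subspace :: "('s \<Rightarrow> complex) set \<Rightarrow> bool" where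
  "linf_subspace E \<longleftrightarrow>
     E \<subseteq> linf \<and> (\<lambda>_. 0) \<in> E \<and>
     (\<forall>f\<in>E. \<forall>g\<in>E. (\<lambda>s. f s + g s) \<in> E) \<and>
     (\<forall>c. \<forall>f\<in>E. (\<lambda>s. c * f s) \<in> E)"

definition linf_norm_closed :: "('s \<Rightarrow> complex) set \<Rightarrow> bool" where
  "linf_norm_closed E \<longleftrightarrow>
     (\<forall>f\<in>linf. (\<forall>e>0. \<exists>g\<in>E. linf_norm (\<lambda>s. f s - g s) < e) \<longrightarrow> f \<in> E)"

definition sub_bimodule :: "('s::semigroup_add \<Rightarrow> complex) set \<Rightarrow> bool" where
  "sub_bimodule E \<longleftrightarrow>
     linf_subspace E \<and> (\<forall>a\<in>l1. \<forall>f\<in>E. left_act a f \<in> E \<and> right_act f a \<in> E)"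

text \<open>
  The dual \<open>E\<^sup>*\<close> of a subspace \<open>E\<close>: bounded complex-linear functionals on \<open>E\<close>. Being
  \<^const>\<open>extensional\<close>, each is represented by exactly one HOL function.
\<close>

definition dual_space :: "('s \<Rightarrow> complex) set \<Rightarrow> (('s \<Rightarrow> complex) \<Rightarrow> complex) set" where
  "dual_space E = {\<phi> \<in> extensional E.
     (\<forall>f\<in>E. \<forall>g\<in>E. \<phi> (\<lambda>s. f s + g s) = \<phi> f + \<phi> g) \<and>
     (\<forall>c. \<forall>f\<in>E. \<phi> (\<lambda>s. c * f s) = c * \<phi> f) \<and>
     (\<exists>K. \<forall>f\<in>E. norm (\<phi> f) \<le> K * linf_norm f)}"

definition dual_norm :: "('s \<Rightarrow> complex) set \<Rightarrow> (('s \<Rightarrow> complex) \<Rightarrow> complex) \<Rightarrow> real" where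
  "dual_norm E \<phi> = (SUP f\<in>{f \<in> E. linf_norm f \<le> 1}. norm (\<phi> f))"

definition canonical_map ::
    "('s \<Rightarrow> complex) set \<Rightarrow> ('s \<Rightarrow> complex) \<Rightarrow> ('s \<Rightarrow> complex) \<Rightarrow> complex" where
  "canonical_map E a = (\<lambda>\<mu>\<in>E. pairing a \<mu>)"

text \<open>
  The canonical map is linear by construction (\<open>canonical_map_add\<close>, \<open>canonical_map_scale\<close>), so
  continuity of the map and of its inverse are the two norm estimates.
\<close>

definition l1_predual :: "('s::semigroup_add \<Rightarrow> complex) set \<Rightarrow> bool" where
  "l1_predual E \<longleftrightarrow>
     sub_bimodule E \<and> linf_norm_closed E \<and>
     bij_betw (canonical_map E) l1 (dual_space E) \<and>
     (\<exists>C. \<forall>a\<in>l1. dual_norm E (canonical_map E a) \<le> C * l1_norm a) \<and>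
     (\<exists>C. \<forall>a\<in>l1. l1_norm a \<le> C * dual_norm E (canonical_map E a))"

definition hopf_algebra_predual :: "('s::semigroup_add \<Rightarrow> complex) set \<Rightarrow> bool" where
  "hopf_algebra_predual E \<longleftrightarrow>
     l1_predual E \<and> (\<forall>f\<in>E. \<forall>g\<in>E. (\<lambda>s. f s * g s) \<in> E)"

section \<open>Consistency of the definitions\<close>

lemma infsum_unit: "(\<Sum>\<^sub>\<infinity>t. l1_unit s t * h t) = h s"
proof -
  have "(\<Sum>\<^sub>\<infinity>t. l1_unit s t * h t) = (\<Sum>\<^sub>\<infinity>t\<in>{s}. l1_unit s t * h t)"
    by (rule infsum_cong_neutral) (auto simp: l1_unit_def)
  then show ?thesis by (simp add: l1_unit_def)
qed

lemma left_act_unit: "left_act (l1_unit s) f t = f (t + s)"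
  unfolding left_act_def by (rule infsum_unit)

lemma right_act_unit: "right_act f (l1_unit s) t = f (s + t)"
  unfolding right_act_def by (rule infsum_unit)

lemma l1_conv_unit: "l1_conv (l1_unit s) (l1_unit t) = l1_unit (s + t)"
proof
  fix u
  have "l1_conv (l1_unit s) (l1_unit t) u
      = (\<Sum>\<^sub>\<infinity>(x, y)\<in>(if s + t = u then {(s, t)} else {}). l1_unit s x * l1_unit t y)"
    unfolding l1_conv_def
    by (rule infsum_cong_neutral) (auto simp: l1_unit_def split: if_splits)
  then show "l1_conv (l1_unit s) (l1_unit t) u = l1_unit (s + t) u"
    by (auto simp: l1_unit_def)
qed

lemma l1_prod_summable:
  assumes "a \<in> l1" "b \<in> l1" "\<And>p. norm (h p) \<le> (K::real)"
  shows "(\<lambda>(r, s). a r * b s * (h (r, s) :: complex)) summable_on UNIV"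
proof -
  have a: "(\<lambda>r. norm (a r)) summable_on UNIV" and b: "(\<lambda>s. norm (b s)) summable_on UNIV"
    using assms by (auto simp: l1_def)
  have "(\<lambda>p. norm (case p of (r, s) \<Rightarrow> a r * b s)) summable_on (UNIV \<times> UNIV)"
    by (subst Infinite_Sum.abs_summable_on_Sigma_iff)
      (auto simp: norm_mult infsum_cmult_right' abs_mult infsum_nonneg
        intro!: summable_on_cmult_right summable_on_cmult_left a b)
  then have "(\<lambda>p. norm (a (fst p) * b (snd p)) * K) summable_on UNIV"
    by (intro summable_on_cmult_left) (simp add: case_prod_unfold)
  then have "(\<lambda>p. norm (a (fst p) * b (snd p) * h p)) summable_on UNIV"
    by (rule summable_on_comparison_test)
      (auto simp: norm_mult intro!: mult_left_mono assms(3))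
  then have "(\<lambda>p. a (fst p) * b (snd p) * h p) summable_on UNIV"
    by (rule abs_summable_summable)
  then show ?thesis by (simp add: case_prod_unfold)
qed

lemma pairing_conv:
  assumes "a \<in> l1" "b \<in> l1" "f \<in> linf"
  shows "pairing (l1_conv a b) f = (\<Sum>\<^sub>\<infinity>(r, s). a r * b s * f (r + s))"
    and "(\<lambda>(r, s). a r * b s * f (r + s)) summable_on UNIV"
proof -
  obtain K where K: "\<And>s. norm (f s) \<le> K"
    using assms(3) by (auto simp: linf_def bounded_iff)
  show sm: "(\<lambda>(r, s). a r * b s * f (r + s)) summable_on UNIV"
    using l1_prod_summable[OF assms(1,2), of "\<lambda>(r, s). f (r + s)" K] K by (simp add: case_prod_unfold)
  define g where "g = (\<lambda>(t::'a, p). case p of (r, s) \<Rightarrow> a r * b s * f (r + s))"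
  define D where "D = (SIGMA t:(UNIV::'a set). {(r, s). r + s = t})"
  have bij: "bij_betw (\<lambda>(r, s). (r + s, (r, s))) UNIV D"
    by (rule bij_betwI[where g = snd]) (auto simp: D_def)
  have smD: "g summable_on D"
    by (subst summable_on_reindex_bij_betw[OF bij, symmetric])
      (use sm in \<open>simp add: g_def case_prod_unfold\<close>)
  have "pairing (l1_conv a b) f = (\<Sum>\<^sub>\<infinity>t. \<Sum>\<^sub>\<infinity>p\<in>{(r, s). r + s = t}. g (t, p))"
    unfolding pairing_def l1_conv_def
    by (intro infsum_cong, subst infsum_cmult_left'[symmetric], intro infsum_cong)
      (auto simp: g_def)
  also have "\<dots> = infsum g D"
    unfolding D_def by (rule infsum_Sigma_banach) (use smD in \<open>simp add: D_def\<close>)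
  also have "\<dots> = (\<Sum>\<^sub>\<infinity>(r, s). a r * b s * f (r + s))"
    by (subst infsum_reindex_bij_betw[OF bij, symmetric]) (simp add: g_def case_prod_unfold)
  finally show "pairing (l1_conv a b) f = (\<Sum>\<^sub>\<infinity>(r, s). a r * b s * f (r + s))" .
qed

lemma pairing_left_act:
  assumes "a \<in> l1" "b \<in> l1" "f \<in> linf"
  shows "pairing b (left_act a f) = pairing (l1_conv b a) f"
proof -
  have "pairing b (left_act a f) = (\<Sum>\<^sub>\<infinity>r. \<Sum>\<^sub>\<infinity>s. b r * a s * f (r + s))"
    by (simp add: pairing_def left_act_def infsum_cmult_right'[symmetric] mult.assoc)
  also have "\<dots> = (\<Sum>\<^sub>\<infinity>(r, s). b r * a s * f (r + s))"
    using infsum_Sigma'_banach[of "\<lambda>r s. b r * a s * f (r + s)" UNIV "\<lambda>_. UNIV"]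
      pairing_conv(2)[OF assms(2,1,3)] by simp
  finally show ?thesis using pairing_conv(1)[OF assms(2,1,3)] by simp
qed

lemma pairing_right_act:
  assumes "a \<in> l1" "b \<in> l1" "f \<in> linf"
  shows "pairing b (right_act f a) = pairing (l1_conv a b) f"
proof -
  have "pairing b (right_act f a) = (\<Sum>\<^sub>\<infinity>s. \<Sum>\<^sub>\<infinity>r. a r * b s * f (r + s))"
    by (simp add: pairing_def right_act_def infsum_cmult_right'[symmetric] mult_ac)
  also have "\<dots> = (\<Sum>\<^sub>\<infinity>r. \<Sum>\<^sub>\<infinity>s. a r * b s * f (r + s))"
    by (rule infsum_swap_banach[symmetric]) (use pairing_conv(2)[OF assms] in simp)
  also have "\<dots> = (\<Sum>\<^sub>\<infinity>(r, s). a r * b s * f (r + s))"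
    using infsum_Sigma'_banach[of "\<lambda>r s. a r * b s * f (r + s)" UNIV "\<lambda>_. UNIV"]
      pairing_conv(2)[OF assms] by simp
  finally show ?thesis using pairing_conv(1)[OF assms] by simp
qed

lemma pairing_summable:
  assumes "a \<in> l1" "f \<in> linf"
  shows "(\<lambda>s. a s * f s) summable_on UNIV"
proof -
  obtain K where K: "\<And>s. norm (f s) \<le> K"
    using assms(2) by (auto simp: linf_def bounded_iff)
  have "(\<lambda>s. norm (a s) * K) summable_on UNIV"
    using assms(1) by (intro summable_on_cmult_left) (simp add: l1_def)
  then have "(\<lambda>s. norm (a s * f s)) summable_on UNIV"
    by (rule summable_on_comparison_test) (auto simp: norm_mult intro!: mult_left_mono K)
  then show ?thesis by (rule abs_summable_summable)
qed

lemma canonical_map_add: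
  assumes "a \<in> l1" "b \<in> l1" "E \<subseteq> linf" "f \<in> E"
  shows "canonical_map E (\<lambda>s. a s + b s) f = canonical_map E a f + canonical_map E b f"
  using assms pairing_summable[of a f] pairing_summable[of b f]
  by (auto simp: canonical_map_def pairing_def distrib_right infsum_add)

lemma canonical_map_scale:
  assumes "f \<in> E"
  shows "canonical_map E (\<lambda>s. c * a s) f = c * canonical_map E a f"
  using assms by (simp add: canonical_map_def pairing_def mult.assoc infsum_cmult_right')

end

theory Submission
  imports Defs
begin

text \<open>
  For a set \<open>A\<close> of naturals consider the topology on \<open>\<int>\<^sub>+ \<times> \<int>\<close> in which \<open>(m, n + 4\<^sup>k)\<close> converges to
  \<open>(m + 1, n)\<close> as \<open>k\<close> runs through \<open>A\<close>. Since sums of distinct powers of \<open>4\<close> determine their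
  exponents, it is locally compact and Hausdorff, and translations are continuous and proper, so
  that the functions vanishing at infinity form a translation invariant closed subalgebra of
  \<open>\<ell>\<^sup>\<infinity>\<close>. Its dual is \<open>\<ell>\<^sup>1\<close>, as measures on a countable space are atomic. The topology determines
  \<open>A\<close> up to a finite set, and there is a continuum of sets which pairwise differ infinitely.

  The representation of functionals is obtained directly: the mass at \<open>s\<close> of a functional \<open>\<phi>\<close> is
  the limit of \<open>\<phi>\<close> at the indicators of small compact open neighbourhoods of \<open>s\<close>, and after
  subtraction of all masses \<open>\<phi>\<close> vanishes by induction on the first coordinate.
\<close>

section \<open>Bounded functions and summable weights\<close>

lemma linf_norm_upper:
  assumes "f \<in> linf"
  shows "norm (f s) \<le> linf_norm f"
proof -
  have "bdd_above (range (\<lambda>s. norm (f s)))"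
    using assms by (auto simp: linf_def bounded_iff bdd_above_def)
  then show ?thesis
    unfolding linf_norm_def by (rule cSUP_upper[rotated]) simp
qed

lemma linf_norm_least: "(\<And>s. norm (f s) \<le> B) \<Longrightarrow> linf_norm f \<le> B"
  unfolding linf_norm_def by (rule cSUP_least) auto

lemma linf_norm_nonneg: "f \<in> linf \<Longrightarrow> 0 \<le> linf_norm f"
  using linf_norm_upper[of f undefined] norm_ge_zero[of "f undefined"] by linarith

lemma linfI: "(\<And>s. norm (f s) \<le> B) \<Longrightarrow> f \<in> linf"
  by (auto simp: linf_def bounded_iff)

lemma linf_add:
  assumes "f \<in> linf" "g \<in> linf"
  shows "(\<lambda>s. f s + g s) \<in> linf"
  by (rule linfI[where B = "linf_norm f + linf_norm g"])
    (meson add_mono assms linf_norm_upper norm_triangle_ineq order_trans)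

lemma linf_mult:
  assumes "f \<in> linf" "g \<in> linf"
  shows "(\<lambda>s. f s * g s) \<in> linf"
  by (rule linfI[where B = "linf_norm f * linf_norm g"])
    (auto simp: norm_mult intro!: mult_mono linf_norm_upper assms linf_norm_nonneg)

lemma linf_cmult: "f \<in> linf \<Longrightarrow> (\<lambda>s. c * f s) \<in> linf"
  by (rule linf_mult) (auto intro: linfI[where B = "norm c"])

lemma l1_norm_nonneg: "0 \<le> l1_norm a"
  unfolding l1_norm_def by (rule infsum_nonneg) simp

lemma norm_pairing_le:
  assumes "a \<in> l1" "\<And>s. norm (f s) \<le> B"
  shows "norm (pairing a f) \<le> l1_norm a * B"
proof -
  have sm: "(\<lambda>s. norm (a s) * B) summable_on UNIV"
    using assms(1) by (intro summable_on_cmult_left) (simp add: l1_def)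
  have le: "norm (a s * f s) \<le> norm (a s) * B" for s
    by (auto simp: norm_mult intro!: mult_left_mono assms(2))
  have sm': "(\<lambda>s. norm (a s * f s)) summable_on UNIV"
    by (rule summable_on_comparison_test[OF sm]) (auto simp: le)
  have "norm (pairing a f) \<le> (\<Sum>\<^sub>\<infinity>s. norm (a s * f s))"
    unfolding pairing_def by (rule norm_infsum_bound[OF sm'])
  also have "\<dots> \<le> (\<Sum>\<^sub>\<infinity>s. norm (a s) * B)"
    by (rule infsum_mono[OF sm' sm]) (rule le)
  also have "\<dots> = l1_norm a * B"
    unfolding l1_norm_def by (rule infsum_cmult_left')
  finally show ?thesis .
qed

lemma right_act_eq_left_act:
  fixes f :: "'s::ab_semigroup_add \<Rightarrow> complex"
  shows "right_act f a = left_act a f"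
  unfolding right_act_def left_act_def by (intro ext infsum_cong) (simp add: add.commute)

lemma pairing_add:
  assumes "a \<in> l1" "f \<in> linf" "g \<in> linf"
  shows "pairing a (\<lambda>s. f s + g s) = pairing a f + pairing a g"
  using pairing_summable[OF assms(1,2)] pairing_summable[OF assms(1,3)]
  by (simp add: pairing_def distrib_left infsum_add)

lemma pairing_cmult: "pairing a (\<lambda>s. c * f s) = c * pairing a f"
  by (simp add: pairing_def mult.left_commute[of _ c] infsum_cmult_right')

text \<open>Reduces the action of a general \<open>a\<close>, and limits of its pairings, to
  finitely many terms plus a small error.\<close>

lemma l1_tail:
  assumes "a \<in> l1" "e > 0"
  obtains F where "finite F" "(\<lambda>s. if s \<in> F then 0 else a s) \<in> l1"
    "l1_norm (\<lambda>s. if s \<in> F then 0 else a s) < e"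
proof -
  have sm: "(\<lambda>s. norm (a s)) summable_on UNIV"
    using assms(1) by (simp add: l1_def)
  then have "((\<lambda>s. norm (a s)) has_sum l1_norm a) UNIV"
    by (simp add: l1_norm_def)
  then have "eventually (\<lambda>F. dist (\<Sum>s\<in>F. norm (a s)) (l1_norm a) < e) (finite_subsets_at_top UNIV)"
    unfolding has_sum_def tendsto_iff using assms(2) by blast
  then obtain F where F: "finite F" "dist (\<Sum>s\<in>F. norm (a s)) (l1_norm a) < e"
    unfolding eventually_finite_subsets_at_top by blast
  let ?b = "\<lambda>s. if s \<in> F then 0 else a s"
  have smF: "(\<lambda>s. norm (a s)) summable_on (UNIV - F)"
    by (rule summable_on_subset_banach[OF sm]) simp
  have eq: "(\<lambda>s. norm (?b s)) summable_on UNIV \<longleftrightarrow> (\<lambda>s. norm (a s)) summable_on (UNIV - F)"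
    by (rule summable_on_cong_neutral) auto
  have "l1_norm ?b = (\<Sum>\<^sub>\<infinity>s\<in>UNIV - F. norm (a s))"
    unfolding l1_norm_def by (rule infsum_cong_neutral) auto
  also have "\<dots> = l1_norm a - (\<Sum>s\<in>F. norm (a s))"
    unfolding l1_norm_def using sm F(1) by (subst infsum_Diff) auto
  also have "\<dots> < e"
    using F(2) by (simp add: dist_real_def)
  finally show thesis
    using that[of F] F(1) eq smF by (simp add: l1_def)
qed

lemma l1_norm_le:
  assumes "\<And>F. finite F \<Longrightarrow> (\<Sum>s\<in>F. norm (a s)) \<le> B"
  shows "a \<in> l1" "l1_norm a \<le> B"
proof -
  have sm: "(\<lambda>s. norm (a s)) summable_on UNIV"
    by (rule nonneg_bounded_partial_sums_imp_summable_on[where C = B])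
      (auto intro!: assms eventually_finite_subsets_at_top_weakI)
  then show "a \<in> l1"
    by (simp add: l1_def)
  show "l1_norm a \<le> B"
    unfolding l1_norm_def by (rule infsum_le_finite_sums[OF sm]) (rule assms)
qed

section \<open>Functions vanishing at infinity for a system of compact open neighbourhoods\<close>

text \<open>
  \<open>U K s\<close> (\<open>K = 0, 1, \<dots>\<close>) plays the role of a decreasing base of compact open neighbourhoods
  of \<open>s\<close> in a locally compact Hausdorff topology with continuous proper translations; \<open>rank\<close> is
  a Cantor--Bendixson type rank, which replaces compactness by an induction.
\<close>

locale nbhd_system =
  fixes U :: "nat \<Rightarrow> 's::ab_semigroup_add \<Rightarrow> 's set" and rank :: "'s \<Rightarrow> nat"
  assumes centre: "s \<in> U K s"
    and antimono: "K \<le> L \<Longrightarrow> U L s \<subseteq> U K s"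
    and nbhd_open: "t \<in> U K s \<Longrightarrow> \<exists>L. U L t \<subseteq> U K s"
    and nbhd_closed: "t \<notin> U K s \<Longrightarrow> \<exists>L. U L t \<inter> U K s = {}"
    and separated: "s \<noteq> t \<Longrightarrow> \<exists>K. U K s \<inter> U K t = {}"
    and translate: "t \<in> U K s \<Longrightarrow> t + r \<in> U K (s + r)"
    and translate_proper: "\<exists>T. finite T \<and> {t. t + r \<in> U 0 s} \<subseteq> (\<Union>t\<in>T. U 0 t)"
    and rank_less: "\<exists>T. finite T \<and> (\<forall>t\<in>T. rank t < rank s) \<and> U 0 s - U L s \<subseteq> (\<Union>t\<in>T. U 0 t)"
begin

text \<open>Continuity at every point, and vanishing at infinity, with finite unions of sets
  \<open>U 0 s\<close> standing for the compact sets.\<close>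

definition C0 :: "('s \<Rightarrow> complex) set" where
  "C0 = {f \<in> linf. (\<forall>s. \<forall>e>0. \<exists>K. \<forall>t\<in>U K s. norm (f t - f s) < e) \<and>
     (\<forall>e>0. \<exists>T. finite T \<and> (\<forall>t. e \<le> norm (f t) \<longrightarrow> t \<in> (\<Union>s\<in>T. U 0 s)))}"

lemma C0_linf: "f \<in> C0 \<Longrightarrow> f \<in> linf"
  by (simp add: C0_def)

lemma C0_cont:
  assumes "f \<in> C0" "e > 0"
  obtains K where "\<And>L t. K \<le> L \<Longrightarrow> t \<in> U L s \<Longrightarrow> norm (f t - f s) < e"
  using assms antimono unfolding C0_def by blast

lemma C0_vanish:
  assumes "f \<in> C0" "e > 0"
  obtains T where "finite T" "\<And>t. e \<le> norm (f t) \<Longrightarrow> t \<in> (\<Union>s\<in>T. U 0 s)"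
  using assms unfolding C0_def by blast

lemma C0I:
  assumes "f \<in> linf" "\<And>s e. e > 0 \<Longrightarrow> \<exists>K. \<forall>t\<in>U K s. norm (f t - f s) < e"
    and "\<And>e. e > 0 \<Longrightarrow> \<exists>T. finite T \<and> (\<forall>t. e \<le> norm (f t) \<longrightarrow> t \<in> (\<Union>s\<in>T. U 0 s))"
  shows "f \<in> C0"
  using assms by (simp add: C0_def)

text \<open>Uniform limits preserve continuity and decay. Besides closedness of the predual, this
  gives the passage from translations to the action of all of \<open>l1\<close>.\<close>

lemma C0_closed:
  assumes "f \<in> linf" "\<And>e. e > 0 \<Longrightarrow> \<exists>g\<in>C0. linf_norm (\<lambda>s. f s - g s) < e"
  shows "f \<in> C0"
proof (rule C0I[OF assms(1)])
  have approx: "\<exists>g\<in>C0. \<forall>s. norm (f s - g s) < e" if e: "e > 0" for e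
  proof -
    obtain g where g: "g \<in> C0" "linf_norm (\<lambda>s. f s - g s) < e"
      using assms(2)[OF e] by blast
    have "(\<lambda>s. f s - g s) \<in> linf"
      using linf_add[OF assms(1) linf_cmult[of g "-1"]] g(1) by (simp add: C0_linf)
    then have "norm (f s - g s) < e" for s
      using linf_norm_upper[of "\<lambda>s. f s - g s" s] g(2) by linarith
    then show ?thesis
      using g(1) by blast
  qed
  show "\<exists>K. \<forall>t\<in>U K s. norm (f t - f s) < e" if e: "e > 0" for s e
  proof -
    obtain g where g: "g \<in> C0" "\<And>s. norm (f s - g s) < e / 3"
      using approx[of "e / 3"] e by auto
    obtain K where K: "\<And>t. t \<in> U K s \<Longrightarrow> norm (g t - g s) < e / 3"
      using C0_cont[OF g(1), of "e / 3" s] e by (metis divide_pos_pos order_refl zero_less_numeral)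
    have "norm (f t - f s) < e" if "t \<in> U K s" for t
    proof -
      have "f t - f s = (f t - g t) + (g t - g s) - (f s - g s)"
        by simp
      then have "norm (f t - f s) \<le> norm (f t - g t) + norm (g t - g s) + norm (f s - g s)"
        by (metis norm_triangle_ineq4 norm_triangle_ineq add_mono_thms_linordered_semiring(3) order_trans)
      then show ?thesis
        using g(2)[of t] g(2)[of s] K[OF that] by linarith
    qed
    then show ?thesis
      by blast
  qed
  show "\<exists>T. finite T \<and> (\<forall>t. e \<le> norm (f t) \<longrightarrow> t \<in> (\<Union>s\<in>T. U 0 s))" if e: "e > 0" for e
  proof -
    obtain g where g: "g \<in> C0" "\<And>s. norm (f s - g s) < e / 2"
      using approx[of "e / 2"] e by auto
    obtain T where T: "finite T" "\<And>t. e / 2 \<le> norm (g t) \<Longrightarrow> t \<in> (\<Union>s\<in>T. U 0 s)"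
      using C0_vanish[OF g(1), of "e / 2"] e by auto
    have "t \<in> (\<Union>s\<in>T. U 0 s)" if "e \<le> norm (f t)" for t
      using that g(2)[of t] norm_triangle_ineq2[of "f t" "g t"] by (intro T(2)) linarith
    then show ?thesis
      using T(1) by blast
  qed
qed

lemma C0_add:
  assumes f: "f \<in> C0" and g: "g \<in> C0"
  shows "(\<lambda>s. f s + g s) \<in> C0"
proof (rule C0I)
  show "(\<lambda>s. f s + g s) \<in> linf"
    using assms by (auto intro: linf_add C0_linf)
  show "\<exists>K. \<forall>t\<in>U K s. norm (f t + g t - (f s + g s)) < e" if e: "e > 0" for s e
  proof -
    obtain K where K: "\<And>L t. K \<le> L \<Longrightarrow> t \<in> U L s \<Longrightarrow> norm (f t - f s) < e / 2"
      using C0_cont[OF f half_gt_zero[OF e], of s] by blast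
    obtain K' where K': "\<And>L t. K' \<le> L \<Longrightarrow> t \<in> U L s \<Longrightarrow> norm (g t - g s) < e / 2"
      using C0_cont[OF g half_gt_zero[OF e], of s] by blast
    have "norm (f t + g t - (f s + g s)) < e" if "t \<in> U (max K K') s" for t
      using K[OF _ that] K'[OF _ that] norm_triangle_ineq[of "f t - f s" "g t - g s"]
      by (simp add: algebra_simps)
    then show ?thesis
      by blast
  qed
  show "\<exists>T. finite T \<and> (\<forall>t. e \<le> norm (f t + g t) \<longrightarrow> t \<in> (\<Union>s\<in>T. U 0 s))" if e: "e > 0" for e
  proof -
    obtain T where T: "finite T" "\<And>t. e / 2 \<le> norm (f t) \<Longrightarrow> t \<in> (\<Union>s\<in>T. U 0 s)"
      using C0_vanish[OF f half_gt_zero[OF e]] by blast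
    obtain T' where T': "finite T'" "\<And>t. e / 2 \<le> norm (g t) \<Longrightarrow> t \<in> (\<Union>s\<in>T'. U 0 s)"
      using C0_vanish[OF g half_gt_zero[OF e]] by blast
    have "t \<in> (\<Union>s\<in>T \<union> T'. U 0 s)" if "e \<le> norm (f t + g t)" for t
    proof -
      have "e / 2 \<le> norm (f t) \<or> e / 2 \<le> norm (g t)"
        using that norm_triangle_ineq[of "f t" "g t"] by linarith
      then show ?thesis
        using T(2) T'(2) by auto
    qed
    then show ?thesis
      using T(1) T'(1) by (intro exI[of _ "T \<union> T'"]) blast
  qed
qed

text \<open>Since \<open>g\<close> is only bounded and continuous, products within \<open>C0\<close>
  and scalar multiples (\<open>g\<close> constant) are both instances.\<close>

lemma C0_bounded_mult:
  assumes f: "f \<in> C0" and g: "g \<in> linf"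
    and cont: "\<And>s e. e > 0 \<Longrightarrow> \<exists>K. \<forall>t\<in>U K s. norm (g t - g s) < e"
  shows "(\<lambda>s. g s * f s) \<in> C0"
proof (rule C0I)
  \<comment> \<open>A common bound for both factors; the summand 1 makes it a legitimate
    divisor.\<close>
  define B where "B = linf_norm f + linf_norm g + 1"
  have B: "B > 0" "\<And>s. norm (f s) \<le> B" "\<And>s. norm (g s) \<le> B"
    using linf_norm_nonneg[OF g] linf_norm_nonneg[OF C0_linf[OF f]]
      linf_norm_upper[OF g] linf_norm_upper[OF C0_linf[OF f]]
    by (auto simp: B_def add_increasing add_increasing2)
  show "(\<lambda>s. g s * f s) \<in> linf"
    using f g by (auto intro: linf_mult C0_linf)
  show "\<exists>K. \<forall>t\<in>U K s. norm (g t * f t - g s * f s) < e" if e: "e > 0" for s e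
  proof -
    have e': "e / (2 * B) > 0"
      using e B by simp
    obtain K where K: "\<And>L t. K \<le> L \<Longrightarrow> t \<in> U L s \<Longrightarrow> norm (f t - f s) < e / (2 * B)"
      using C0_cont[OF f e'] by blast
    obtain K' where K': "\<And>t. t \<in> U K' s \<Longrightarrow> norm (g t - g s) < e / (2 * B)"
      using cont[OF e'] by blast
    have "norm (g t * f t - g s * f s) < e" if t: "t \<in> U (max K K') s" for t
    proof -
      have "g t * f t - g s * f s = g t * (f t - f s) + (g t - g s) * f s"
        by (simp add: algebra_simps)
      then have "norm (g t * f t - g s * f s) \<le> norm (g t) * norm (f t - f s) + norm (g t - g s) * norm (f s)"
        by (metis norm_mult norm_triangle_ineq)
      also have "\<dots> \<le> B * norm (f t - f s) + norm (g t - g s) * B"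
        by (intro add_mono mult_left_mono mult_right_mono B) auto
      also have "\<dots> < B * (e / (2 * B)) + (e / (2 * B)) * B"
        using K[OF _ t] K'[of t] antimono[of K' "max K K'" s] t B(1)
        by (intro add_strict_mono mult_strict_left_mono mult_strict_right_mono) auto
      also have "\<dots> = e"
        using B by simp
      finally show ?thesis .
    qed
    then show ?thesis
      by blast
  qed
  show "\<exists>T. finite T \<and> (\<forall>t. e \<le> norm (g t * f t) \<longrightarrow> t \<in> (\<Union>s\<in>T. U 0 s))" if e: "e > 0" for e
  proof -
    obtain T where T: "finite T" "\<And>t. e / B \<le> norm (f t) \<Longrightarrow> t \<in> (\<Union>s\<in>T. U 0 s)"
      using C0_vanish[OF f, of "e / B"] e B by auto
    have "t \<in> (\<Union>s\<in>T. U 0 s)" if t: "e \<le> norm (g t * f t)" for t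
    proof (rule T(2))
      have "e \<le> B * norm (f t)"
        using t mult_right_mono[OF B(3)[of t], of "norm (f t)"] by (simp add: norm_mult)
      then show "e / B \<le> norm (f t)"
        using B(1) by (simp add: field_simps)
    qed
    then show ?thesis
      using T(1) by blast
  qed
qed

lemma C0_mult: "f \<in> C0 \<Longrightarrow> g \<in> C0 \<Longrightarrow> (\<lambda>s. f s * g s) \<in> C0"
  by (rule C0_bounded_mult) (auto simp: C0_def)

lemma C0_cmult: "f \<in> C0 \<Longrightarrow> (\<lambda>s. c * f s) \<in> C0"
  by (rule C0_bounded_mult) (auto intro: linfI[where B = "norm c"])

lemma C0_zero: "(\<lambda>_. 0) \<in> C0"
  by (rule C0I) (auto intro: linfI[where B = 0])

lemma C0_diff: "f \<in> C0 \<Longrightarrow> g \<in> C0 \<Longrightarrow> (\<lambda>s. f s - g s) \<in> C0"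
  using C0_add[of f "\<lambda>s. -1 * g s"] C0_cmult[of g "-1"] by simp

lemma C0_sum: "finite I \<Longrightarrow> (\<And>i. i \<in> I \<Longrightarrow> f i \<in> C0) \<Longrightarrow> (\<lambda>s. \<Sum>i\<in>I. f i s) \<in> C0"
  by (induction I rule: finite_induct) (auto simp: C0_zero C0_add)

section \<open>Translations and the module action\<close>

lemma C0_translate:
  assumes f: "f \<in> C0"
  shows "(\<lambda>t. f (t + r)) \<in> C0"
proof (rule C0I)
  show "(\<lambda>t. f (t + r)) \<in> linf"
    using linf_norm_upper[OF C0_linf[OF f]] by (rule linfI)
  show "\<exists>K. \<forall>t\<in>U K s. norm (f (t + r) - f (s + r)) < e" if "e > 0" for s e
    using C0_cont[OF f that, of "s + r"] translate by (metis order_refl)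
  show "\<exists>T. finite T \<and> (\<forall>t. e \<le> norm (f (t + r)) \<longrightarrow> t \<in> (\<Union>s\<in>T. U 0 s))" if e: "e > 0" for e
  proof -
    obtain T where T: "finite T" "\<And>t. e \<le> norm (f t) \<Longrightarrow> t \<in> (\<Union>s\<in>T. U 0 s)"
      using C0_vanish[OF f e] by blast
    \<comment> \<open>Properness pulls each covering set back into finitely many sets
      \<open>U 0 t\<close>, so finite covers are passed on to the translate.\<close>
    obtain P where P: "\<And>s. finite (P s)" "\<And>s. {t. t + r \<in> U 0 s} \<subseteq> (\<Union>t\<in>P s. U 0 t)"
      using translate_proper[of r] by metis
    have "t \<in> (\<Union>s\<in>(\<Union>s\<in>T. P s). U 0 s)" if "e \<le> norm (f (t + r))" for t
      using T(2)[OF that] P(2) by fastforce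
    then show ?thesis
      using T(1) P(1) by (intro exI[of _ "\<Union>s\<in>T. P s"]) blast
  qed
qed

text \<open>A truncation of \<open>a\<close> to a finite set acts by a finite combination of
  translations, and the tail contributes at most its \<open>l1_norm\<close> times
  \<open>linf_norm f\<close>; then \<open>C0_closed\<close> applies.\<close>

lemma C0_left_act:
  assumes a: "a \<in> l1" and f: "f \<in> C0"
  shows "left_act a f \<in> C0"
proof (rule C0_closed)
  have shift: "left_act b f t = pairing b (\<lambda>s. f (t + s))" for b t
    by (simp add: left_act_def pairing_def)
  have bound: "norm (left_act b f t) \<le> l1_norm b * linf_norm f" if "b \<in> l1" for b t
    unfolding shift by (rule norm_pairing_le[OF that]) (rule linf_norm_upper[OF C0_linf[OF f]])
  show "left_act a f \<in> linf"
    using bound[OF a] by (rule linfI)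
  fix e :: real
  assume e: "e > 0"
  define B where "B = linf_norm f + 1"
  have B: "B > 0" "linf_norm f \<le> B"
    using linf_norm_nonneg[OF C0_linf[OF f]] by (auto simp: B_def)
  obtain F where F: "finite F" "(\<lambda>s. if s \<in> F then 0 else a s) \<in> l1"
    "l1_norm (\<lambda>s. if s \<in> F then 0 else a s) < e / (2 * B)"
    using l1_tail[OF a, of "e / (2 * B)"] e B by auto
  let ?b = "\<lambda>s. if s \<in> F then 0 else a s"
  define g where "g = (\<lambda>t. \<Sum>s\<in>F. a s * f (t + s))"
  have "g \<in> C0"
    unfolding g_def by (intro C0_sum F C0_cmult C0_translate f)
  moreover have "left_act a f t - g t = left_act ?b f t" for t
  proof -
    have linf: "(\<lambda>s. f (t + s)) \<in> linf"
      by (rule linfI) (rule linf_norm_upper[OF C0_linf[OF f]])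
    have "left_act a f t - g t = (\<Sum>\<^sub>\<infinity>s\<in>UNIV - F. a s * f (t + s))"
      unfolding left_act_def g_def
      using pairing_summable[OF a linf] F(1) by (subst infsum_Diff) auto
    also have "\<dots> = left_act ?b f t"
      unfolding left_act_def by (rule infsum_cong_neutral) auto
    finally show ?thesis .
  qed
  moreover have "linf_norm (left_act ?b f) \<le> e / (2 * B) * B"
    using bound[OF F(2)] F(3) B l1_norm_nonneg[of ?b] linf_norm_nonneg[OF C0_linf[OF f]]
    by (intro linf_norm_least) (meson mult_mono less_imp_le order_trans e zero_le_divide_iff mult_nonneg_nonneg)
  moreover have "e / (2 * B) * B < e"
    using B e by simp
  ultimately show "\<exists>g\<in>C0. linf_norm (\<lambda>s. left_act a f s - g s) < e"
    by (intro bexI[of _ g]) (auto intro: le_less_trans)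
qed

lemma sub_bimodule_C0: "sub_bimodule C0"
  unfolding sub_bimodule_def linf_subspace_def
  by (auto simp: C0_linf C0_zero C0_add C0_cmult C0_left_act right_act_eq_left_act)

lemma linf_norm_closed_C0: "linf_norm_closed C0"
  unfolding linf_norm_closed_def using C0_closed by blast

section \<open>Indicators of the compact open neighbourhoods\<close>

lemma indicator_nbhd_cont:
  assumes "e > 0"
  shows "\<exists>L. \<forall>t\<in>U L r. norm (indicator (U K s) t - indicator (U K s) r :: complex) < e"
proof (cases "r \<in> U K s")
  case True
  then obtain L where "U L r \<subseteq> U K s"
    using nbhd_open by blast
  then show ?thesis
    using assms True by (intro exI[of _ L]) (auto simp: indicator_def)
next
  case False
  then obtain L where "U L r \<inter> U K s = {}"
    using nbhd_closed by blast
  then show ?thesis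
    using assms False by (intro exI[of _ L]) (auto simp: indicator_def)
qed

lemma indicator_nbhd: "indicator (U K s) \<in> C0"
proof (rule C0I)
  show "\<exists>T. finite T \<and> (\<forall>t. e \<le> norm (indicator (U K s) t :: complex) \<longrightarrow> t \<in> (\<Union>s\<in>T. U 0 s))"
    if "e > 0" for e
    using antimono[of 0 K s] that by (intro exI[of _ "{s}"]) (auto simp: indicator_def)
next
  show "indicator (U K s) \<in> linf"
    by (rule linfI[where B = 1]) (simp add: indicator_def)
qed (rule indicator_nbhd_cont)

text \<open>Prepares the use of \<open>functional_disjoint\<close> for neighbourhoods of finitely
  many points.\<close>

lemma eventually_disjoint:
  assumes "finite F"
  shows "eventually (\<lambda>K. disjoint_family_on (U K) F) sequentially"
proof -
  have "eventually (\<lambda>K. U K s \<inter> U K t = {}) sequentially" if st: "s \<noteq> t" for s t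
  proof -
    obtain K where "U K s \<inter> U K t = {}"
      using separated[OF st] by blast
    then have "U L s \<inter> U L t = {}" if "K \<le> L" for L
      using antimono[OF that, of s] antimono[OF that, of t] by blast
    then show ?thesis
      unfolding eventually_sequentially by blast
  qed
  then have "eventually (\<lambda>K. \<forall>s\<in>F. \<forall>t\<in>F. s \<noteq> t \<longrightarrow> U K s \<inter> U K t = {}) sequentially"
    by (auto simp: eventually_ball_finite_distrib assms intro: eventually_mono)
  then show ?thesis
    by (simp add: disjoint_family_on_def)
qed

section \<open>Bounded functionals\<close>

text \<open>Values off \<open>C0\<close> are left free, unlike in \<open>dual_space\<close>, so that
  \<open>pairing a\<close> and differences of functionals qualify directly. The bound
  \<open>M\<close> is explicit because it becomes the bound on the \<open>l1_norm\<close> of the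
  representing weight.\<close>

definition functional :: "real \<Rightarrow> (('s \<Rightarrow> complex) \<Rightarrow> complex) \<Rightarrow> bool" where
  "functional M \<phi> \<longleftrightarrow> 0 \<le> M \<and>
     (\<forall>f\<in>C0. \<forall>g\<in>C0. \<phi> (\<lambda>s. f s + g s) = \<phi> f + \<phi> g) \<and>
     (\<forall>c. \<forall>f\<in>C0. \<phi> (\<lambda>s. c * f s) = c * \<phi> f) \<and>
     (\<forall>f\<in>C0. norm (\<phi> f) \<le> M * linf_norm f)"

context
  fixes M \<phi>
  assumes \<phi>: "functional M \<phi>"
begin

lemma functional_add: "f \<in> C0 \<Longrightarrow> g \<in> C0 \<Longrightarrow> \<phi> (\<lambda>s. f s + g s) = \<phi> f + \<phi> g"
  and functional_cmult: "f \<in> C0 \<Longrightarrow> \<phi> (\<lambda>s. c * f s) = c * \<phi> f"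
  and functional_nonneg: "0 \<le> M"
  using \<phi> by (auto simp: functional_def)

lemma functional_le:
  assumes "f \<in> C0" "\<And>s. norm (f s) \<le> B"
  shows "norm (\<phi> f) \<le> M * B"
proof -
  have "norm (\<phi> f) \<le> M * linf_norm f"
    using \<phi> assms(1) by (auto simp: functional_def)
  also have "\<dots> \<le> M * B"
    by (intro mult_left_mono linf_norm_least assms functional_nonneg)
  finally show ?thesis .
qed

lemma functional_diff:
  assumes "f \<in> C0" "g \<in> C0"
  shows "\<phi> (\<lambda>s. f s - g s) = \<phi> f - \<phi> g"
  using functional_add[OF assms(1) C0_cmult[OF assms(2), of "-1"]] functional_cmult[OF assms(2), of "-1"]
  by simp

lemma functional_sum:
  assumes "finite I" "\<And>i. i \<in> I \<Longrightarrow> f i \<in> C0"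
  shows "\<phi> (\<lambda>s. \<Sum>i\<in>I. f i s) = (\<Sum>i\<in>I. \<phi> (f i))"
  using assms
proof (induction I rule: finite_induct)
  case empty
  then show ?case
    using functional_cmult[OF C0_zero, of 0] by simp
next
  case (insert i I)
  then show ?case
    using functional_add[of "f i" "\<lambda>s. \<Sum>i\<in>I. f i s"] C0_sum[of I f] by simp
qed

text \<open>A total variation bound: the functional is tested on a combination of the indicators
  whose coefficients cancel the phases of its values. Disjointness keeps the norm of this
  combination at most 1.\<close>

lemma functional_disjoint:
  assumes I: "finite I" and C0: "\<And>i. i \<in> I \<Longrightarrow> indicator (V i) \<in> C0" and disj: "disjoint_family_on V I"
  shows "(\<Sum>i\<in>I. norm (\<phi> (indicator (V i)))) \<le> M"
proof -
  define c where "c i = cnj (sgn (\<phi> (indicator (V i))))" for i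
  define g where "g = (\<lambda>s. \<Sum>i\<in>I. c i * indicator (V i) s)"
  have c1: "norm (c i) \<le> 1" for i
    by (simp add: c_def norm_sgn)
  have ph: "c i * \<phi> (indicator (V i)) = of_real (norm (\<phi> (indicator (V i))))" for i
  proof -
    have "c i * \<phi> (indicator (V i)) = \<phi> (indicator (V i)) * cnj (\<phi> (indicator (V i))) / norm (\<phi> (indicator (V i)))"
      by (simp add: c_def sgn_eq)
    then show ?thesis
      by (simp add: complex_norm_square[symmetric] power2_eq_square)
  qed
  have "g \<in> C0"
    unfolding g_def by (intro C0_sum I C0_cmult C0)
  moreover have "norm (g s) \<le> 1" for s
  proof (cases "\<exists>i\<in>I. s \<in> V i")
    case True
    then obtain i where i: "i \<in> I" "s \<in> V i"
      by blast
    have "g s = (\<Sum>j\<in>{i}. c j * indicator (V j) s)"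
      unfolding g_def using i disj I
      by (intro sum.mono_neutral_right) (auto simp: disjoint_family_on_def indicator_def)
    then show ?thesis
      using c1 i by simp
  next
    case False
    then have "g s = 0"
      by (auto simp: g_def intro!: sum.neutral)
    then show ?thesis
      by simp
  qed
  ultimately have "norm (\<phi> g) \<le> M"
    using functional_le[of g 1] by simp
  moreover have "\<phi> g = (\<Sum>i\<in>I. c i * \<phi> (indicator (V i)))"
    unfolding g_def using C0 by (simp add: functional_sum[OF I] C0_cmult functional_cmult)
  then have "\<phi> g = of_real (\<Sum>i\<in>I. norm (\<phi> (indicator (V i))))"
    by (simp add: ph)
  ultimately show ?thesis
    by (simp add: norm_of_real sum_nonneg del: of_real_sum)
qed

text \<open>The sets \<open>U 0 t\<close> are peeled off one at a time: removing the part of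
  \<open>f\<close> on one of them does not change the value of the functional, and what finally
  remains is at most \<open>e\<close> everywhere.\<close>

lemma functional_cover:
  assumes T: "finite T" and zero: "\<And>t g. t \<in> T \<Longrightarrow> g \<in> C0 \<Longrightarrow> \<phi> (\<lambda>s. indicator (U 0 t) s * g s) = 0"
    and f: "f \<in> C0" and small: "\<And>s. s \<notin> (\<Union>t\<in>T. U 0 t) \<Longrightarrow> norm (f s) \<le> e" and e: "0 \<le> e"
  shows "norm (\<phi> f) \<le> M * e"
  using T zero f small
proof (induction T arbitrary: f rule: finite_induct)
  case empty
  then show ?case
    by (intro functional_le) auto
next
  case (insert t T)
  let ?h = "\<lambda>s. indicator (U 0 t) s * f s"
  have h: "?h \<in> C0"
    by (intro C0_mult indicator_nbhd insert.prems)
  have "norm (\<phi> (\<lambda>s. f s - ?h s)) \<le> M * e"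
  proof (rule insert.IH)
    show "norm (f s - ?h s) \<le> e" if "s \<notin> (\<Union>t\<in>T. U 0 t)" for s
      using insert.prems(3)[of s] that e by (auto simp: indicator_def)
  qed (auto intro: insert.prems C0_diff h)
  then show ?case
    using insert.prems(1)[of t f] insert.prems(2) functional_diff[OF insert.prems(2) h] by simp
qed

text \<open>
  Compactness argument: outside \<open>U L s\<close> the function is carried by neighbourhoods of smaller
  rank, and on \<open>U L s\<close> it is nearly constant.
\<close>

lemma functional_eq_zero:
  assumes lim: "\<And>s. (\<lambda>K. \<phi> (indicator (U K s))) \<longlonglongrightarrow> 0" and f: "f \<in> C0"
  shows "\<phi> f = 0"
proof -
  have local: "\<phi> (\<lambda>t. indicator (U 0 s) t * g t) = 0" if "g \<in> C0" for s g
    using that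
  proof (induction "rank s" arbitrary: s g rule: less_induct)
    case less
    let ?g = "\<lambda>t. indicator (U 0 s) t * g t"
    have g0: "?g \<in> C0"
      by (intro C0_mult indicator_nbhd less)
    have "norm (\<phi> ?g) \<le> e * (norm (g s) + M)" if e: "e > 0" for e
    proof -
      obtain K where K: "\<And>L t. K \<le> L \<Longrightarrow> t \<in> U L s \<Longrightarrow> norm (g t - g s) < e"
        using C0_cont[OF less(2) e] by blast
      obtain K' where K': "\<And>L. K' \<le> L \<Longrightarrow> norm (\<phi> (indicator (U L s))) < e"
        using lim[of s] e by (auto simp: LIMSEQ_iff)
      define L where "L = max K K'"
      obtain T where T: "finite T" "\<And>t. t \<in> T \<Longrightarrow> rank t < rank s" "U 0 s - U L s \<subseteq> (\<Union>t\<in>T. U 0 t)"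
        using rank_less[of s L] by blast
      let ?h = "\<lambda>t. g s * indicator (U L s) t"
      have h: "?h \<in> C0"
        by (rule C0_cmult[OF indicator_nbhd])
      have "norm (\<phi> (\<lambda>t. ?g t - ?h t)) \<le> M * e"
      proof (rule functional_cover[OF T(1)])
        \<comment> \<open>A point outside the cover lies in \<open>U L s\<close>, where the
          difference is \<open>g t - g s\<close>, or outside \<open>U 0 s\<close>, where both
          functions vanish.\<close>
        show "norm (?g t - ?h t) \<le> e" if "t \<notin> (\<Union>t\<in>T. U 0 t)" for t
          using that T(3) K[of L t] antimono[of 0 L s] e by (auto simp: indicator_def L_def less_imp_le)
      qed (use less(1) T(2) e g0 h C0_diff in auto)
      moreover have "norm (\<phi> ?h) \<le> norm (g s) * e"
        using functional_cmult[OF indicator_nbhd[of L s], of "g s"] K'[of L]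
        by (auto simp: norm_mult L_def intro!: mult_left_mono)
      moreover have "norm (\<phi> ?g) \<le> norm (\<phi> (\<lambda>t. ?g t - ?h t)) + norm (\<phi> ?h)"
        unfolding functional_diff[OF g0 h] using norm_triangle_ineq2[of "\<phi> ?g" "\<phi> ?h"] by linarith
      moreover have "e * (norm (g s) + M) = M * e + norm (g s) * e"
        by (simp add: algebra_simps)
      ultimately show ?thesis
        by linarith
    qed
    then have "norm (\<phi> ?g) \<le> e" if "e > 0" for e
    proof -
      have p: "norm (g s) + M + 1 > 0"
        using functional_nonneg norm_ge_zero[of "g s"] by linarith
      have "norm (\<phi> ?g) \<le> e / (norm (g s) + M + 1) * (norm (g s) + M)"
        using that p by (intro \<open>\<And>e. e > 0 \<Longrightarrow> norm (\<phi> ?g) \<le> e * (norm (g s) + M)\<close>) simp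
      also have "\<dots> \<le> e"
        using that p by (simp add: field_simps)
      finally show ?thesis .
    qed
    then show ?case
      by (metis field_le_epsilon add_0 norm_le_zero_iff)
  qed
  have *: "norm (\<phi> f) \<le> M * e" if e: "e > 0" for e
  proof -
    obtain T where T: "finite T" "\<And>t. e \<le> norm (f t) \<Longrightarrow> t \<in> (\<Union>s\<in>T. U 0 s)"
      using C0_vanish[OF f e] by blast
    show ?thesis
      by (rule functional_cover[OF T(1) local f]) (use T(2) e in force)+
  qed
  have "norm (\<phi> f) \<le> 0 + e" if e: "e > 0" for e
  proof -
    have "norm (\<phi> f) \<le> M * (e / (M + 1))"
      using e functional_nonneg by (intro *) auto
    also have "\<dots> \<le> e"
      using e functional_nonneg by (simp add: field_simps)
    finally show ?thesis
      by simp
  qed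
  then show ?thesis
    by (metis field_le_epsilon norm_le_zero_iff)
qed

text \<open>The rings \<open>U K s - U (Suc K) s\<close> are disjoint, so by
  \<open>functional_disjoint\<close> the values at their indicators are absolutely summable; these
  values telescope. The limit is the mass at \<open>s\<close>.\<close>

lemma functional_convergent: "convergent (\<lambda>K. \<phi> (indicator (U K s)))"
proof -
  define V where "V K = U K s - U (Suc K) s" for K
  have V: "indicator (V K) = (\<lambda>t. indicator (U K s) t - indicator (U (Suc K) s) t :: complex)" for K
    using antimono[of K "Suc K" s] by (auto simp: V_def indicator_def fun_eq_iff)
  have "V K \<inter> V L = {}" if "K < L" for K L
    using antimono[of "Suc K" L s] that by (auto simp: V_def)
  then have disj: "disjoint_family_on V I" for I
    unfolding disjoint_family_on_def by (metis inf_commute linorder_neqE_nat)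
  have "(\<Sum>K<n. norm (\<phi> (indicator (V K)))) \<le> M" for n
    by (rule functional_disjoint) (auto intro: disj simp: V C0_diff indicator_nbhd)
  then have "summable (\<lambda>K. norm (\<phi> (indicator (V K))))"
    by (intro bounded_imp_summable[where B = M]) (auto simp only: lessThan_Suc_atMost[symmetric] norm_ge_zero)
  then have "summable (\<lambda>K. \<phi> (indicator (V K)))"
    by (rule summable_norm_cancel)
  moreover have "\<phi> (indicator (V K)) = \<phi> (indicator (U K s)) - \<phi> (indicator (U (Suc K) s))" for K
    unfolding V by (rule functional_diff) (rule indicator_nbhd)+
  ultimately have "convergent (\<lambda>n. \<Sum>K<n. \<phi> (indicator (U K s)) - \<phi> (indicator (U (Suc K) s)))"
    by (simp add: summable_iff_convergent)
  then have "convergent (\<lambda>n. \<phi> (indicator (U 0 s)) - \<phi> (indicator (U n s)))"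
    by (simp only: sum_lessThan_telescope'[where f = "\<lambda>K. \<phi> (indicator (U K s))"])
  from convergent_diff[OF convergent_const[of "\<phi> (indicator (U 0 s))"] this] show ?thesis
    by simp
qed

text \<open>For large \<open>K\<close> the neighbourhoods of the points of \<open>F\<close> are
  disjoint and \<open>functional_disjoint\<close> applies before the limit. This serves both to make
  the masses summable and to bound the inverse of the canonical map.\<close>

lemma functional_limit_le:
  assumes lim: "\<And>s. (\<lambda>K. \<phi> (indicator (U K s))) \<longlonglongrightarrow> a s" and F: "finite F"
  shows "(\<Sum>s\<in>F. norm (a s)) \<le> M"
proof (rule tendsto_upperbound)
  show "(\<lambda>K. \<Sum>s\<in>F. norm (\<phi> (indicator (U K s)))) \<longlonglongrightarrow> (\<Sum>s\<in>F. norm (a s))"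
    by (intro tendsto_intros lim)
  show "eventually (\<lambda>K. (\<Sum>s\<in>F. norm (\<phi> (indicator (U K s)))) \<le> M) sequentially"
    using eventually_disjoint[OF F]
    by eventually_elim (auto intro: functional_disjoint[OF F] indicator_nbhd)
qed simp

end

text \<open>While shrinking to \<open>s\<close>, the sets \<open>U K s\<close> lose every other
  point of a finite set that carries most of \<open>a\<close>. Weights are thus recovered from their
  functionals, which yields injectivity.\<close>

lemma pairing_nbhd_limit:
  assumes a: "a \<in> l1"
  shows "(\<lambda>K. pairing a (indicator (U K s))) \<longlonglongrightarrow> a s"
proof (rule tendstoI)
  fix e :: real
  assume "e > 0"
  then obtain F where F: "finite F" "(\<lambda>s. if s \<in> F then 0 else a s) \<in> l1"
    "l1_norm (\<lambda>s. if s \<in> F then 0 else a s) < e"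
    using l1_tail[OF a] by blast
  let ?b = "\<lambda>s. if s \<in> F then 0 else a s"
  have "eventually (\<lambda>K. \<forall>t\<in>F. t \<noteq> s \<longrightarrow> t \<notin> U K s) sequentially"
  proof -
    have "eventually (\<lambda>K. t \<notin> U K s) sequentially" if ts: "t \<noteq> s" for t
    proof -
      obtain K where "U K t \<inter> U K s = {}"
        using separated[OF ts] by blast
      then have "t \<notin> U L s" if "K \<le> L" for L
        using antimono[OF that, of s] centre[of t K] by blast
      then show ?thesis
        unfolding eventually_sequentially by blast
    qed
    then show ?thesis
      by (auto simp: eventually_ball_finite_distrib F(1) intro: eventually_mono)
  qed
  then show "eventually (\<lambda>K. dist (pairing a (indicator (U K s))) (a s) < e) sequentially"
  proof eventually_elim
    case (elim K)
    let ?g = "\<lambda>t. indicator (U K s) t - indicator {s} t :: complex"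
    have linf: "indicator V \<in> linf" for V :: "'s set"
      by (rule linfI[where B = 1]) (simp add: indicator_def)
    have g: "?g \<in> linf"
      by (rule linfI[where B = 1]) (simp add: indicator_def)
    have "a s = (\<Sum>\<^sub>\<infinity>t\<in>{s}. a t * indicator {s} t)"
      by simp
    also have "\<dots> = pairing a (indicator {s})"
      unfolding pairing_def by (rule infsum_cong_neutral) auto
    finally have "pairing a (indicator (U K s)) - a s = pairing a ?g"
      using pairing_add[OF a g linf[of "{s}"]] by simp
    \<comment> \<open>The test function vanishes at \<open>s\<close>, and every other point of
      \<open>F\<close> has left \<open>U K s\<close>; only the tail of \<open>a\<close>
      contributes.\<close>
    also have "\<dots> = pairing ?b ?g"
      unfolding pairing_def using elim centre[of s K] by (intro infsum_cong) (auto simp: indicator_def)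
    finally have "norm (pairing a (indicator (U K s)) - a s) \<le> l1_norm ?b * 1"
      using norm_pairing_le[OF F(2), of ?g 1] by (simp add: indicator_def)
    then show ?case
      using F(3) by (simp add: dist_norm)
  qed
qed

lemma functional_pairing:
  assumes a: "a \<in> l1"
  shows "functional (l1_norm a) (pairing a)"
  using a unfolding functional_def
  by (auto simp: pairing_add pairing_cmult C0_linf l1_norm_nonneg
      intro!: norm_pairing_le linf_norm_upper)

text \<open>Subtracting the functional given by the point masses leaves one without masses, which is
  0 by \<open>functional_eq_zero\<close>. This is the surjectivity of the canonical map.\<close>

lemma functional_representation:
  assumes \<phi>: "functional M \<phi>"
  obtains a where "a \<in> l1" "\<And>f. f \<in> C0 \<Longrightarrow> \<phi> f = pairing a f"
proof -
  obtain a where lim: "\<And>s. (\<lambda>K. \<phi> (indicator (U K s))) \<longlonglongrightarrow> a s"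
    using functional_convergent[OF \<phi>] unfolding convergent_def by metis
  have a: "a \<in> l1"
    using functional_limit_le[OF \<phi> lim] by (rule l1_norm_le)
  let ?\<psi> = "\<lambda>f. \<phi> f - pairing a f"
  note \<alpha> = functional_pairing[OF a]
  have "functional (M + l1_norm a) ?\<psi>"
    unfolding functional_def
  proof (intro conjI ballI allI)
    show "norm (?\<psi> f) \<le> (M + l1_norm a) * linf_norm f" if f: "f \<in> C0" for f
      using functional_le[OF \<phi> f linf_norm_upper[OF C0_linf[OF f]]]
        functional_le[OF \<alpha> f linf_norm_upper[OF C0_linf[OF f]]] norm_triangle_ineq4[of "\<phi> f" "pairing a f"]
      by (simp add: distrib_right)
  qed (auto simp: functional_nonneg[OF \<phi>] l1_norm_nonneg functional_add[OF \<phi>] functional_add[OF \<alpha>]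
      functional_cmult[OF \<phi>] functional_cmult[OF \<alpha>] algebra_simps)
  moreover have "(\<lambda>K. ?\<psi> (indicator (U K s))) \<longlonglongrightarrow> 0" for s
    using tendsto_diff[OF lim[of s] pairing_nbhd_limit[OF a, of s]] by simp
  ultimately have "?\<psi> f = 0" if "f \<in> C0" for f
    using that by (rule functional_eq_zero)
  then show thesis
    using that[OF a] by simp
qed

section \<open>The predual property\<close>

lemma dual_space_functional:
  assumes "\<phi> \<in> dual_space C0"
  obtains M where "functional M \<phi>"
proof -
  obtain K where K: "\<And>f. f \<in> C0 \<Longrightarrow> norm (\<phi> f) \<le> K * linf_norm f"
    using assms unfolding dual_space_def by blast
  have "norm (\<phi> f) \<le> max K 0 * linf_norm f" if "f \<in> C0" for f
    using K[OF that] mult_right_mono[of K "max K 0" "linf_norm f"] linf_norm_nonneg[OF C0_linf[OF that]]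
    by simp
  then have "functional (max K 0) \<phi>"
    using assms by (auto simp: dual_space_def functional_def)
  then show thesis
    by (rule that)
qed

lemma canonical_map_in_dual:
  assumes "a \<in> l1"
  shows "canonical_map C0 a \<in> dual_space C0"
  using functional_pairing[OF assms] unfolding functional_def dual_space_def canonical_map_def
  by (auto simp: C0_add C0_cmult)

lemma bij_canonical_map: "bij_betw (canonical_map C0) l1 (dual_space C0)"
  unfolding bij_betw_def
proof
  show "inj_on (canonical_map C0) l1"
  proof (rule inj_onI, rule ext)
    fix a b s
    assume a: "a \<in> l1" and b: "b \<in> l1" and eq: "canonical_map C0 a = canonical_map C0 b"
    have "pairing a (indicator (U K s)) = pairing b (indicator (U K s))" for K
      using fun_cong[OF eq, of "indicator (U K s)"] indicator_nbhd by (simp add: canonical_map_def)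
    then show "a s = b s"
      using pairing_nbhd_limit[OF a, of s] pairing_nbhd_limit[OF b, of s] LIMSEQ_unique by simp
  qed
  show "canonical_map C0 ` l1 = dual_space C0"
  proof (intro equalityI subsetI)
    fix \<phi>
    assume \<phi>: "\<phi> \<in> dual_space C0"
    then obtain M where "functional M \<phi>"
      by (rule dual_space_functional)
    then obtain a where a: "a \<in> l1" "\<And>f. f \<in> C0 \<Longrightarrow> \<phi> f = pairing a f"
      by (rule functional_representation) blast
    have "\<phi> = canonical_map C0 a"
      using \<phi> a(2) by (auto simp: canonical_map_def dual_space_def extensional_def fun_eq_iff)
    then show "\<phi> \<in> canonical_map C0 ` l1"
      using a(1) by blast
  qed (auto intro: canonical_map_in_dual)
qed

text \<open>Makes the dual norm an admissible bound in \<open>functional\<close>, by rescaling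
  \<open>f\<close> to the unit ball.\<close>

lemma norm_pairing_le_dual_norm:
  assumes a: "a \<in> l1" and f: "f \<in> C0"
  shows "norm (pairing a f) \<le> dual_norm C0 (canonical_map C0 a) * linf_norm f"
proof -
  let ?D = "{f \<in> C0. linf_norm f \<le> 1}"
  let ?N = "dual_norm C0 (canonical_map C0 a)"
  have bdd: "bdd_above ((\<lambda>f. norm (canonical_map C0 a f)) ` ?D)"
  proof (rule bdd_aboveI2)
    fix f
    assume f: "f \<in> ?D"
    then have "norm (f s) \<le> 1" for s
      using linf_norm_upper[of f s] C0_linf[of f] by simp
    then show "norm (canonical_map C0 a f) \<le> l1_norm a * 1"
      using f norm_pairing_le[OF a, of f 1] by (simp add: canonical_map_def)
  qed
  show ?thesis
  proof (cases "linf_norm f = 0")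
    case True
    have "norm (pairing a f) \<le> l1_norm a * linf_norm f"
      by (rule norm_pairing_le[OF a]) (rule linf_norm_upper[OF C0_linf[OF f]])
    then show ?thesis
      using True by simp
  next
    case False
    then have pos: "linf_norm f > 0"
      using linf_norm_nonneg[OF C0_linf[OF f]] by simp
    define c where "c = complex_of_real (inverse (linf_norm f))"
    have c: "norm c * linf_norm f = 1"
      using pos by (simp add: c_def norm_inverse)
    have g: "(\<lambda>s. c * f s) \<in> C0"
      by (rule C0_cmult[OF f])
    moreover have "norm (c * f s) \<le> 1" for s
      using mult_left_mono[OF linf_norm_upper[OF C0_linf[OF f]], of "norm c" s] c by (simp add: norm_mult)
    then have "linf_norm (\<lambda>s. c * f s) \<le> 1"
      by (rule linf_norm_least)
    ultimately have "norm (canonical_map C0 a (\<lambda>s. c * f s)) \<le> ?N"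
      unfolding dual_norm_def by (intro cSUP_upper bdd) auto
    then have "norm c * norm (pairing a f) \<le> ?N"
      using g by (simp add: canonical_map_def pairing_cmult norm_mult)
    then have "norm c * linf_norm f * norm (pairing a f) \<le> ?N * linf_norm f"
      using mult_right_mono[OF _ less_imp_le[OF pos]] by (metis mult.assoc mult.commute)
    then show ?thesis
      using c by simp
  qed
qed

lemma dual_norm_nonneg:
  assumes a: "a \<in> l1"
  shows "0 \<le> dual_norm C0 (canonical_map C0 a)"
proof -
  \<comment> \<open>A function of positive norm, around an arbitrary point, to read off the
    sign.\<close>
  let ?f = "indicator (U 0 undefined) :: 's \<Rightarrow> complex"
  have f: "?f \<in> C0"
    by (rule indicator_nbhd)
  have "linf_norm ?f \<ge> 1"
    using linf_norm_upper[OF C0_linf[OF f], of undefined] centre by simp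
  moreover have "0 \<le> dual_norm C0 (canonical_map C0 a) * linf_norm ?f"
    using norm_ge_zero norm_pairing_le_dual_norm[OF a f] by (rule order_trans)
  ultimately show ?thesis
    by (simp add: zero_le_mult_iff)
qed

text \<open>\<open>functional_limit_le\<close> with the dual norm as bound controls all finite sums
  of the masses, which are the values of \<open>a\<close>. With \<open>dual_norm_le_l1_norm\<close>
  the canonical map is even isometric.\<close>

lemma l1_norm_le_dual_norm:
  assumes a: "a \<in> l1"
  shows "l1_norm a \<le> dual_norm C0 (canonical_map C0 a)"
proof -
  have "functional (dual_norm C0 (canonical_map C0 a)) (pairing a)"
    using functional_pairing[OF a] norm_pairing_le_dual_norm[OF a] dual_norm_nonneg[OF a]
    by (simp add: functional_def)
  from functional_limit_le[OF this pairing_nbhd_limit[OF a]] show ?thesis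
    by (rule l1_norm_le)
qed

lemma dual_norm_le_l1_norm:
  assumes a: "a \<in> l1"
  shows "dual_norm C0 (canonical_map C0 a) \<le> l1_norm a"
  unfolding dual_norm_def
proof (rule cSUP_least)
  have "linf_norm (\<lambda>_::'s. 0 :: complex) \<le> 1"
    by (rule linf_norm_least) simp
  then show "{f \<in> C0. linf_norm f \<le> 1} \<noteq> {}"
    using C0_zero by blast
  fix f
  assume "f \<in> {f \<in> C0. linf_norm f \<le> 1}"
  then have f: "f \<in> C0" "linf_norm f \<le> 1"
    by auto
  have "norm (pairing a f) \<le> l1_norm a * 1"
    using linf_norm_upper[OF C0_linf[OF f(1)]] f(2) by (intro norm_pairing_le a) (rule order_trans)
  then show "norm (canonical_map C0 a f) \<le> l1_norm a"
    using f by (simp add: canonical_map_def)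
qed

theorem hopf_algebra_predual_C0: "hopf_algebra_predual C0"
  unfolding hopf_algebra_predual_def l1_predual_def
  using sub_bimodule_C0 linf_norm_closed_C0 bij_canonical_map C0_mult
  by (auto intro!: exI[of _ 1] simp: l1_norm_le_dual_norm dual_norm_le_l1_norm)

end

section \<open>Topologies on the semigroup\<close>

text \<open>Iterated limits: each \<open>k\<close> in \<open>F\<close> accounts for one passage from
  \<open>(m + 1, n)\<close> to \<open>(m, n + 4 ^ k)\<close>. The equation
  \<open>fst t + card F = fst s\<close> avoids truncated subtraction and restricts
  \<open>card F\<close> to at most \<open>fst s\<close>.\<close>

definition nbhd :: "nat set \<Rightarrow> nat \<Rightarrow> nat \<times> int \<Rightarrow> (nat \<times> int) set" where
  "nbhd A K s = {t. \<exists>F. finite F \<and> F \<subseteq> A \<inter> {K..} \<and> fst t + card F = fst s \<and>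
     snd t = snd s + (\<Sum>k\<in>F. 4 ^ k)}"

section \<open>Arithmetic of sums of distinct powers of 4\<close>

lemma sum_powers_less:
  assumes "H \<subseteq> {..<L::nat}"
  shows "3 * (\<Sum>k\<in>H. 4 ^ k :: int) < 4 ^ L"
proof -
  have "(\<Sum>k\<in>H. 4 ^ k :: int) \<le> (\<Sum>k<L. 4 ^ k)"
    using assms by (intro sum_mono2) auto
  moreover have "3 * (\<Sum>k<L. 4 ^ k :: int) < 4 ^ L"
    by (induction L) auto
  ultimately show ?thesis
    by linarith
qed

lemma sum_powers_inj:
  assumes "finite F" "finite G" "(\<Sum>k\<in>F. 4 ^ k :: int) = (\<Sum>k\<in>G. 4 ^ k)"
  shows "F \<subseteq> G"
proof (rule ccontr)
  text \<open>The largest index in the symmetric difference decides which sum is larger.\<close>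
  assume "\<not> F \<subseteq> G"
  define D where "D = (F - G) \<union> (G - F)"
  have D: "finite D" "D \<noteq> {}"
    using assms \<open>\<not> F \<subseteq> G\<close> by (auto simp: D_def)
  define m where "m = Max D"
  have m: "m \<in> D" "\<And>k. k \<in> D \<Longrightarrow> k \<le> m"
    using D by (auto simp: m_def)
  have *: False if XY: "finite X" "finite Y" "X - Y \<subseteq> D" "Y - X \<subseteq> D" "m \<in> X - Y"
    and eq: "(\<Sum>k\<in>X. 4 ^ k :: int) = (\<Sum>k\<in>Y. 4 ^ k)" for X Y
  proof -
    have "(\<Sum>k\<in>X. 4 ^ k :: int) = (\<Sum>k\<in>X - Y. 4 ^ k) + (\<Sum>k\<in>X \<inter> Y. 4 ^ k)"
      "(\<Sum>k\<in>Y. 4 ^ k :: int) = (\<Sum>k\<in>Y - X. 4 ^ k) + (\<Sum>k\<in>X \<inter> Y. 4 ^ k)"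
      using XY(1,2) by (subst sum.union_disjoint[symmetric]; force intro: sum.cong)+
    then have "(\<Sum>k\<in>X - Y. 4 ^ k :: int) = (\<Sum>k\<in>Y - X. 4 ^ k)"
      using eq by linarith
    moreover have "(4::int) ^ m \<le> (\<Sum>k\<in>X - Y. 4 ^ k)"
      using XY by (intro member_le_sum) auto
    moreover have "Y - X \<subseteq> {..<m}"
      using XY(4,5) m(2) by (force simp: order_less_le)
    then have "3 * (\<Sum>k\<in>Y - X. 4 ^ k :: int) < 4 ^ m"
      by (rule sum_powers_less)
    moreover have "0 \<le> (\<Sum>k\<in>Y - X. 4 ^ k :: int)"
      by (rule sum_nonneg) simp
    ultimately show False
      by linarith
  qed
  show False
    using m(1) *[of F G] *[of G F] assms by (auto simp: D_def)
qed

text \<open>Split \<open>F\<close> at \<open>L\<close>. The part above and \<open>G\<close> have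
  sums differing by a multiple of \<open>4 ^ L\<close>. This difference is the low part minus
  \<open>d\<close>, of absolute value below \<open>4 ^ L\<close> (a third from the low part, two
  thirds from \<open>d\<close>), hence 0.\<close>

lemma sum_powers_split:
  assumes F: "finite F" and G: "finite G" "G \<subseteq> {L..}"
    and eq: "(\<Sum>k\<in>F. 4 ^ k) = d + (\<Sum>k\<in>G. 4 ^ k :: int)" and d: "3 * \<bar>d\<bar> < 2 * 4 ^ L"
  shows "G \<subseteq> F" "(\<Sum>k\<in>F - G. 4 ^ k) = d"
proof -
  let ?S = "\<lambda>X. \<Sum>k\<in>X. 4 ^ k :: int"
  define H where "H = F \<inter> {..<L}"
  define T where "T = F \<inter> {L..}"
  have F': "F = H \<union> T" "H \<inter> T = {}" "finite H" "finite T"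
    using F by (auto simp: H_def T_def)
  have dvd: "4 ^ L dvd ?S X" if "X \<subseteq> {L..}" for X
    using that by (intro dvd_sum) (auto intro: le_imp_power_dvd)
  have "4 ^ L dvd ?S G - ?S T"
    using dvd[of G] dvd[of T] G(2) by (auto simp: T_def)
  moreover have e: "?S G - ?S T = ?S H - d"
    using eq F' by (simp add: sum.union_disjoint)
  moreover have "3 * ?S H < 4 ^ L" "0 \<le> ?S H"
    by (rule sum_powers_less) (auto simp: H_def intro: sum_nonneg)
  then have "\<bar>?S H - d\<bar> < 4 ^ L"
    using d by linarith
  ultimately have "?S H = d" "?S G = ?S T"
    using dvd_imp_le_int[of "?S H - d" "4 ^ L"] by fastforce+
  moreover have "G = T"
    using sum_powers_inj[OF G(1) F'(4)] sum_powers_inj[OF F'(4) G(1)] \<open>?S G = ?S T\<close> by auto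
  moreover have "F - T = H"
    using F' by blast
  ultimately show "G \<subseteq> F" "?S (F - G) = d"
    using F' by auto
qed

section \<open>Verification of the neighbourhood axioms\<close>

lemma nbhd_closed:
  assumes "t \<notin> nbhd A K s"
  shows "\<exists>L. nbhd A L t \<inter> nbhd A K s = {}"
proof -
  define d where "d = snd t - snd s"
  \<comment> \<open>Makes \<open>4 ^ L\<close> dominate \<open>d\<close> as
    \<open>sum_powers_split\<close> requires.\<close>
  define L where "L = Suc (nat \<bar>d\<bar>)"
  have "int (nat \<bar>d\<bar>) < 2 ^ nat \<bar>d\<bar>"
    by (rule of_nat_less_two_power)
  also have "(2::int) ^ nat \<bar>d\<bar> \<le> 4 ^ nat \<bar>d\<bar>"
    by (rule power_mono) auto
  finally have d: "3 * \<bar>d\<bar> < 2 * 4 ^ L"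
    by (simp add: L_def)
  have False if "r \<in> nbhd A L t" "r \<in> nbhd A K s" for r
  proof -
    obtain G where G: "finite G" "G \<subseteq> A \<inter> {L..}" "fst r + card G = fst t" "snd r = snd t + (\<Sum>k\<in>G. 4 ^ k)"
      using \<open>r \<in> nbhd A L t\<close> by (auto simp: nbhd_def)
    obtain F where F: "finite F" "F \<subseteq> A \<inter> {K..}" "fst r + card F = fst s" "snd r = snd s + (\<Sum>k\<in>F. 4 ^ k)"
      using \<open>r \<in> nbhd A K s\<close> by (auto simp: nbhd_def)
    have "(\<Sum>k\<in>F. 4 ^ k) = d + (\<Sum>k\<in>G. 4 ^ k)" "G \<subseteq> {L..}"
      using F(4) G(2,4) by (auto simp: d_def)
    \<comment> \<open>The exponents leading from \<open>t\<close> to the common point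
      \<open>r\<close> are among those leading from \<open>s\<close> to \<open>r\<close>; the others
      lead from \<open>s\<close> to \<open>t\<close>.\<close>
    note split = sum_powers_split[OF F(1) G(1) this(2,1) d]
    have "card F = card G + card (F - G)"
      using split(1) F(1) by (simp add: card_Diff_subset[OF G(1)] card_mono)
    then have "t \<in> nbhd A K s"
      unfolding nbhd_def using F G(3) split(2)
      by (intro CollectI exI[of _ "F - G"]) (auto simp: d_def)
    then show False
      using assms by blast
  qed
  then show ?thesis
    by blast
qed

lemma nbhd_centre: "s \<in> nbhd A K s"
  unfolding nbhd_def by (intro CollectI exI[of _ "{}"]) simp

lemma nbhd_antimono: "K \<le> L \<Longrightarrow> nbhd A L s \<subseteq> nbhd A K s"
  unfolding nbhd_def by fastforce

lemma nbhd_fst: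
  assumes "t \<in> nbhd A K s" "t \<noteq> s"
  shows "fst t < fst s"
proof -
  obtain F where F: "finite F" "fst t + card F = fst s" "snd t = snd s + (\<Sum>k\<in>F. 4 ^ k)"
    using assms(1) by (auto simp: nbhd_def)
  then have "F \<noteq> {}"
    using assms(2) by (auto simp: prod_eq_iff)
  then have "card F > 0"
    using F(1) by (simp add: card_gt_0_iff)
  then show ?thesis
    using F(2) by linarith
qed

lemma nbhd_open:
  assumes "t \<in> nbhd A K s"
  shows "\<exists>L. nbhd A L t \<subseteq> nbhd A K s"
proof -
  obtain F where F: "finite F" "F \<subseteq> A \<inter> {K..}" "fst t + card F = fst s" "snd t = snd s + (\<Sum>k\<in>F. 4 ^ k)"
    using assms by (auto simp: nbhd_def)
  \<comment> \<open>Beyond all of \<open>F\<close>, so that the exponents used from \<open>t\<close>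
    onwards are new.\<close>
  obtain L where L: "\<And>k. k \<in> F \<Longrightarrow> k < L" "K \<le> L"
    using finite_nat_set_iff_bounded[of F] F(1) by (metis max.cobounded2 max.strict_coboundedI1)
  have "r \<in> nbhd A K s" if r: "r \<in> nbhd A L t" for r
  proof -
    obtain G where G: "finite G" "G \<subseteq> A \<inter> {L..}" "fst r + card G = fst t" "snd r = snd t + (\<Sum>k\<in>G. 4 ^ k)"
      using r by (auto simp: nbhd_def)
    have disj: "F \<inter> G = {}"
      using L(1) G(2) by fastforce
    show ?thesis
      unfolding nbhd_def using F G L(2) disj
      by (intro CollectI exI[of _ "F \<union> G"]) (auto simp: card_Un_disjoint sum.union_disjoint)
  qed
  then show ?thesis
    by blast
qed

text \<open>Two distinct points cannot lie in each other's neighbourhoods, as the first coordinate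
  drops strictly; the excluded one is separated by \<open>nbhd_closed\<close>.\<close>

lemma nbhd_separated:
  assumes "s \<noteq> t"
  shows "\<exists>K. nbhd A K s \<inter> nbhd A K t = {}"
proof -
  have *: "\<exists>K. nbhd A K s \<inter> nbhd A K t = {}" if ts: "t \<notin> nbhd A 0 s" for s t
  proof -
    obtain L where "nbhd A L t \<inter> nbhd A 0 s = {}"
      using nbhd_closed[OF ts] by blast
    then show ?thesis
      using nbhd_antimono[of 0 L A s] by blast
  qed
  have "t \<notin> nbhd A 0 s \<or> s \<notin> nbhd A 0 t"
    using nbhd_fst[of s A 0 t] nbhd_fst[of t A 0 s] assms by force
  then show ?thesis
    using *[of s t] *[of t s] by blast
qed

lemma nbhd_translate: "t \<in> nbhd A K s \<Longrightarrow> t + r \<in> nbhd A K (s + r)"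
  unfolding nbhd_def by force

text \<open>A single neighbourhood suffices. Truncation in \<open>fst s - fst r\<close> is harmless,
  because any \<open>t\<close> in the preimage forces \<open>fst r\<close> to be at most
  \<open>fst s\<close>.\<close>

lemma nbhd_translate_proper: "\<exists>T. finite T \<and> {t. t + r \<in> nbhd A 0 s} \<subseteq> (\<Union>t\<in>T. nbhd A 0 t)"
proof -
  have "t \<in> nbhd A 0 (fst s - fst r, snd s - snd r)" if tr: "t + r \<in> nbhd A 0 s" for t
  proof -
    obtain F where F: "finite F" "F \<subseteq> A \<inter> {0..}"
      "fst (t + r) + card F = fst s" "snd (t + r) = snd s + (\<Sum>k\<in>F. 4 ^ k)"
      using tr unfolding nbhd_def by blast
    have "fst t + card F = fst s - fst r"
      using F(3) by (simp flip: F(3))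
    moreover have "snd t = snd s - snd r + (\<Sum>k\<in>F. 4 ^ k)"
      using F(4) by simp
    ultimately show ?thesis
      unfolding nbhd_def mem_Collect_eq fst_conv snd_conv using F(1,2) by blast
  qed
  then have "{t. t + r \<in> nbhd A 0 s} \<subseteq> (\<Union>t\<in>{(fst s - fst r, snd s - snd r)}. nbhd A 0 t)"
    by blast
  then show ?thesis
    by (meson finite.emptyI finite.insertI)
qed

text \<open>A point outside \<open>nbhd A L s\<close> uses some exponent \<open>k\<close> below
  \<open>L\<close>; applying \<open>k\<close> first moves the centre to
  \<open>(fst s - 1, snd s + 4 ^ k)\<close>.\<close>

lemma nbhd_rank:
  "\<exists>T. finite T \<and> (\<forall>t\<in>T. fst t < fst s) \<and> nbhd A 0 s - nbhd A L s \<subseteq> (\<Union>t\<in>T. nbhd A 0 t)"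
proof (intro exI conjI)
  \<comment> \<open>The condition on \<open>fst t\<close> discards every candidate when
    \<open>fst s\<close> is 0 and the subtraction truncates.\<close>
  let ?T = "{t \<in> (\<lambda>k. (fst s - 1, snd s + 4 ^ k)) ` {..<L}. fst t < fst s}"
  show "finite ?T" "\<forall>t\<in>?T. fst t < fst s"
    by auto
  show "nbhd A 0 s - nbhd A L s \<subseteq> (\<Union>t\<in>?T. nbhd A 0 t)"
  proof
    fix t
    assume t: "t \<in> nbhd A 0 s - nbhd A L s"
    then obtain F where F: "finite F" "F \<subseteq> A" "fst t + card F = fst s" "snd t = snd s + (\<Sum>k\<in>F. 4 ^ k)"
      by (auto simp: nbhd_def)
    then have "\<not> F \<subseteq> {L..}"
      using t by (auto simp: nbhd_def)
    then obtain k where k: "k \<in> F" "k < L"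
      by force
    have F': "card F = Suc (card (F - {k}))" "(\<Sum>k\<in>F. 4 ^ k :: int) = 4 ^ k + (\<Sum>k\<in>F - {k}. 4 ^ k)"
      by (rule card.remove[OF F(1) k(1)], rule sum.remove[OF F(1) k(1)])
    have "fst t + card (F - {k}) = fst s - 1" "snd t = snd s + 4 ^ k + (\<Sum>k\<in>F - {k}. 4 ^ k)"
      using F(3,4) unfolding F' by linarith+
    then have "t \<in> nbhd A 0 (fst s - 1, snd s + 4 ^ k)"
      unfolding nbhd_def using F(1,2) by (intro CollectI exI[of _ "F - {k}"]) auto
    then show "t \<in> (\<Union>t\<in>?T. nbhd A 0 t)"
      using k(2) F(3) F'(1) by (intro UN_I[of "(fst s - 1, snd s + 4 ^ k)"]) (simp_all only: image_iff mem_Collect_eq fst_conv, force)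
  qed
qed

section \<open>The resulting preduals and their distinctness\<close>

interpretation nbhd: nbhd_system "nbhd A" fst for A
  by unfold_locales
    (fact nbhd_centre nbhd_antimono nbhd_open nbhd_closed nbhd_separated nbhd_translate
      nbhd_translate_proper nbhd_rank)+

text \<open>The indicator of \<open>nbhd B 0 (1, 0)\<close> is continuous for \<open>A\<close> as
  well, and \<open>(0, 4 ^ k)\<close> tends to \<open>(1, 0)\<close> along \<open>A\<close>. So
  these points finally lie in \<open>nbhd B 0 (1, 0)\<close>, and uniqueness of exponents puts
  \<open>k\<close> in \<open>B\<close>.\<close>

lemma C0_nbhd_subset_imp:
  assumes "nbhd.C0 B \<subseteq> nbhd.C0 A"
  shows "\<exists>K. A \<inter> {K..} \<subseteq> B"
proof -
  let ?f = "indicator (nbhd B 0 (1, 0)) :: nat \<times> int \<Rightarrow> complex"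
  have "?f \<in> nbhd.C0 A"
    using assms nbhd.indicator_nbhd by blast
  then obtain K where K: "\<And>L t. K \<le> L \<Longrightarrow> t \<in> nbhd A L (1, 0) \<Longrightarrow> norm (?f t - ?f (1, 0)) < 1"
    by (rule nbhd.C0_cont[where e = 1]) auto
  have "k \<in> B" if k: "k \<in> A" "K \<le> k" for k
  proof -
    have "(0, 4 ^ k) \<in> nbhd A K (1, 0)"
      unfolding nbhd_def using k by (intro CollectI exI[of _ "{k}"]) auto
    then have "norm (?f (0, 4 ^ k) - ?f (1, 0)) < 1"
      by (intro K) auto
    then have "(0, 4 ^ k) \<in> nbhd B 0 (1, 0)"
      using nbhd_centre[of "(1, 0)" B 0]
      by (cases "(0, 4 ^ k) \<in> nbhd B 0 (1, 0)") (simp_all add: indicator_def)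
    then obtain F where F: "finite F" "F \<subseteq> B" "(4::int) ^ k = (\<Sum>k\<in>F. 4 ^ k)"
      by (auto simp: nbhd_def)
    then show ?thesis
      using sum_powers_inj[of "{k}" F] by auto
  qed
  then show ?thesis
    by auto
qed

text \<open>
  Only the tail of \<open>A\<close> is visible in the topology of \<open>nbhd A\<close>, so a set \<open>X\<close> is coded by one that
  meets \<open>range (\<lambda>i. prod_encode (x, i))\<close> infinitely often or not at all.
\<close>

lemma inj_C0_nbhd: "inj (\<lambda>X. nbhd.C0 (prod_encode ` (X \<times> UNIV)))"
proof -
  have "X \<subseteq> Y" if eq: "nbhd.C0 (prod_encode ` (X \<times> UNIV)) = nbhd.C0 (prod_encode ` (Y \<times> UNIV))" for X Y
  proof
    fix x
    assume x: "x \<in> X"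
    obtain K where K: "prod_encode ` (X \<times> UNIV) \<inter> {K..} \<subseteq> prod_encode ` (Y \<times> UNIV)"
      using C0_nbhd_subset_imp eq by blast
    \<comment> \<open>The second component \<open>K\<close> places the code in the tail, since
      \<open>prod_encode (x, K)\<close> is at least \<open>K\<close>.\<close>
    have "prod_encode (x, K) \<in> prod_encode ` (Y \<times> UNIV)"
      using K x le_prod_encode_2[of K x] by blast
    then show "x \<in> Y"
      by (auto simp: inj_image_mem_iff[OF inj_prod_encode])
  qed
  then show ?thesis
    by (intro injI) blast
qed

theorem theorem3p7:
  shows "\<exists>\<E> :: (nat \<times> int \<Rightarrow> complex) set set.
           \<E> \<approx> (UNIV :: nat set set) \<and> (\<forall>E\<in>\<E>. hopf_algebra_predual E)"
proof (intro exI conjI)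
  let ?C = "\<lambda>X. nbhd.C0 (prod_encode ` (X \<times> UNIV))"
  show "range ?C \<approx> (UNIV :: nat set set)"
    by (rule inj_on_image_eqpoll_self[OF inj_C0_nbhd])
  show "\<forall>E\<in>range ?C. hopf_algebra_predual E"
    using nbhd.hopf_algebra_predual_C0 by blast
qed

end
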